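(* For a monogenic semigroup $X=\{x^k\}_{k\in\mathbb N}$ the following conditions are equivalent: (1) $\lambda(X)$ is commutative; (2) $\lambda^\bullet(X)$ is commutative; (3) $x^n=x^m$ for some $(n,m)\in\{(1,2),(1,3),(2,3),(1,4),(2,4),(3,4),(1,5),(2,5),(3,5),(4,5),(2,6)\}$.
   Context: $\mathbb N=\{1,2,3,\dots\}$. A semigroup is monogenic if it is generated by a single element $x$. An upfamily on a nonempty set $X$ is a nonempty family $\mathcal F$ of nonempty subsets of $X$ such that $F\in\mathcal F$ and $F\subset E\subset X$ imply $E\in\mathcal F$; $\upsilon(X)$ is the set of all upfamilies on $X$. A family $\mathcal G$ of nonempty subsets of $X$ generates the upfamily $\langle G:G\in\mathcal G\rangle=\{E\subset X:\exists G\in\mathcal G,\ G\subset E\}$. An upfamily $\mathcal F$ is linked if $A\cap B\ne\emptyset$ for all $A,B\in\mathcal F$; it is maximal linked if it is linked and coincides with every linked upfamily containing it. $\lambda(X)$ is the set of maximal linked upfamilies. An upfamily is finitely supported if it equals $\langle F_1,\dots,F_n\rangle$ for some (finitely many, at least one) nonempty finite sets $F_i\subset X$; $\lambda^\bullet(X)$ is the set of finitely supported maximal linked upfamilies. If $X$ is a semigroup, put for $\mathcal A,\mathcal B\in\upsilon(X)$: $\mathcal A*\mathcal B=\langle\bigcup_{a\in A}aB_a: A\in\mathcal A,\ (B_a)_{a\in A}\in\mathcal B^A\rangle$. The operation $*$ is associative and $\lambda(X)$, $\lambda^\bullet(X)$ are subsemigroups of $(\upsilon(X),* )$; their commutativity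 refers to $*$. *)

theory Defs
  imports Main
begin

text \<open>A semigroup is a type of class \<open>semigroup_mult\<close>; the underlying nonempty set \<open>X\<close> is the
  whole type.\<close>

text \<open>A bare semigroup has no unit, so the library power is not available. Exponents range over
  the positive integers; the value at exponent \<open>0\<close> (namely \<open>x\<close>) is meaningless.\<close>

definition spow :: "'a::semigroup_mult \<Rightarrow> nat \<Rightarrow> 'a"
  where "spow x k = (((*) x) ^^ (k - 1)) x"

definition upfamily :: "'a set set \<Rightarrow> bool"
  where "upfamily \<F> \<longleftrightarrow> \<F> \<noteq> {} \<and> {} \<notin> \<F> \<and> (\<forall>F E. F \<in> \<F> \<longrightarrow> F \<subseteq> E \<longrightarrow> E \<in> \<F>)"

definition generated :: "'a set set \<Rightarrow> 'a set set"
  where "generated \<G> = {E. \<exists>G\<in>\<G>. G \<subseteq> E}"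

definition linked :: "'a set set \<Rightarrow> bool"
  where "linked \<F> \<longleftrightarrow> (\<forall>A\<in>\<F>. \<forall>B\<in>\<F>. A \<inter> B \<noteq> {})"

definition maximal_linked :: "'a set set \<Rightarrow> bool"
  where "maximal_linked \<F> \<longleftrightarrow> upfamily \<F> \<and> linked \<F> \<and>
    (\<forall>\<E>. upfamily \<E> \<and> linked \<E> \<and> \<F> \<subseteq> \<E> \<longrightarrow> \<E> = \<F>)"

definition finitely_supported :: "'a set set \<Rightarrow> bool"
  where "finitely_supported \<F> \<longleftrightarrow>
    (\<exists>\<G>. finite \<G> \<and> \<G> \<noteq> {} \<and> (\<forall>G\<in>\<G>. finite G \<and> G \<noteq> {}) \<and> \<F> = generated \<G>)"

definition superext :: "'a set set set"
  where "superext = {\<F>. maximal_linked \<F>}"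

definition fin_superext :: "'a set set set"
  where "fin_superext = {\<F> \<in> superext. finitely_supported \<F>}"

text \<open>The indexed families \<open>(B a)\<close>, \<open>a \<in> A\<close>, are total functions of which only the values on \<open>A\<close>
  are constrained and used.\<close>

definition upmult :: "'a::semigroup_mult set set \<Rightarrow> 'a set set \<Rightarrow> 'a set set"
  where "upmult \<A> \<B> =
    generated {(\<Union>a\<in>A. (\<lambda>b. a * b) ` B a) | A B. A \<in> \<A> \<and> (\<forall>a\<in>A. B a \<in> \<B>)}"

definition upmult_commutative_on :: "'a::semigroup_mult set set set \<Rightarrow> bool"
  where "upmult_commutative_on S \<longleftrightarrow> (\<forall>\<A>\<in>S. \<forall>\<B>\<in>S. upmult \<A> \<B> = upmult \<B> \<A>)"

end

theory Submission imports Defs begin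

text \<open>A maximal linked upfamily is a monotone self-dual family of sets, and
  \<open>E \<in> \<A> * \<B>\<close> iff \<open>{a. {b. a * b \<in> E} \<in> \<B>} \<in> \<A>\<close>. So commutativity is an exchange of two
  quantifiers for every colouring \<open>E\<close>.

  If the powers of \<open>x\<close> satisfy none of the listed coincidences, the exchange fails already for
  majorities over three points: over \<open>x, x\<^sup>2, x\<^sup>3\<close> against one over \<open>x, x\<^sup>2, x\<^sup>4\<close> or over
  \<open>x, x\<^sup>3, x\<^sup>4\<close>, for a suitable two-element \<open>E\<close>.

  Conversely, a coincidence yields indices \<open>s a \<in> {1..4}\<close> such that \<open>a * b\<close> is the power of \<open>x\<close>
  with exponent \<open>s a + s b\<close>. Hence only the images of \<open>\<A>\<close> and \<open>\<B>\<close> on four indices matter; these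
  are among twelve Boolean functions, for which the exchange is a finite check.\<close>

section \<open>Maximal linked upfamilies and membership in their products\<close>

text \<open>If \<open>E\<close> outside \<open>\<F>\<close> met every member, adjoining all
  supersets of \<open>E\<close> would give a larger linked upfamily; so some member is disjoint from
  \<open>E\<close>. Conversely, duality puts \<open>- E\<close> in \<open>\<F>\<close> for each
  \<open>E\<close> outside it, so no linked extension contains \<open>E\<close>.\<close>

lemma maximal_linked_iff:
  "maximal_linked \<F> \<longleftrightarrow> (\<forall>A B. A \<in> \<F> \<longrightarrow> A \<subseteq> B \<longrightarrow> B \<in> \<F>) \<and> (\<forall>E. - E \<in> \<F> \<longleftrightarrow> E \<notin> \<F>)"
  (is "_ \<longleftrightarrow> ?up \<and> ?dual")
proof
  assume max: "maximal_linked \<F>"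
  then have up: ?up and link: "\<And>A B. A \<in> \<F> \<Longrightarrow> B \<in> \<F> \<Longrightarrow> A \<inter> B \<noteq> {}"
    and ne: "\<F> \<noteq> {}" "{} \<notin> \<F>"
    unfolding maximal_linked_def upfamily_def linked_def by blast+
  have "- E \<in> \<F> \<longleftrightarrow> E \<notin> \<F>" for E
  proof
    assume "- E \<in> \<F>"
    then show "E \<notin> \<F>" using link by blast
  next
    assume E: "E \<notin> \<F>"
    have "\<exists>A\<in>\<F>. A \<inter> E = {}"
    proof (rule ccontr)
      assume "\<not> (\<exists>A\<in>\<F>. A \<inter> E = {})"
      then have meet: "\<And>A. A \<in> \<F> \<Longrightarrow> A \<inter> E \<noteq> {}" by blast
      then have "E \<noteq> {}" using ne by blast
      let ?\<E> = "\<F> \<union> {S. E \<subseteq> S}"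
      have "upfamily ?\<E>"
        using up ne \<open>E \<noteq> {}\<close> unfolding upfamily_def by blast
      moreover have "linked ?\<E>"
        unfolding linked_def
      proof (intro ballI)
        fix A B assume "A \<in> ?\<E>" "B \<in> ?\<E>"
        then show "A \<inter> B \<noteq> {}"
          using link[of A B] meet[of A] meet[of B] \<open>E \<noteq> {}\<close> by blast
      qed
      ultimately have "?\<E> = \<F>"
        using max unfolding maximal_linked_def by blast
      then show False using E by blast
    qed
    then show "- E \<in> \<F>" using up by blast
  qed
  with up show "?up \<and> ?dual" by blast
next
  assume asm: "?up \<and> ?dual"
  then have up: "\<And>A B. A \<in> \<F> \<Longrightarrow> A \<subseteq> B \<Longrightarrow> B \<in> \<F>"
    and dual: "\<And>E. - E \<in> \<F> \<longleftrightarrow> E \<notin> \<F>" by blast+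
  have meet: "A \<inter> B \<noteq> {}" if "A \<in> \<F>" "B \<in> \<F>" for A B
    using up[OF that(1), of "- B"] dual[of B] that by blast
  have "upfamily \<F>"
    unfolding upfamily_def using up dual meet by blast
  moreover have "linked \<F>"
    unfolding linked_def using meet by blast
  moreover have "\<E> = \<F>" if \<E>: "linked \<E>" "\<F> \<subseteq> \<E>" for \<E>
    using that dual unfolding linked_def by (metis Compl_disjoint subset_antisym subsetD subsetI)
  ultimately show "maximal_linked \<F>"
    unfolding maximal_linked_def by blast
qed

lemma superextD:
  assumes "\<A> \<in> superext"
  shows "A \<in> \<A> \<Longrightarrow> A \<subseteq> B \<Longrightarrow> B \<in> \<A>" and "- E \<in> \<A> \<longleftrightarrow> E \<notin> \<A>"
  using assms unfolding superext_def mem_Collect_eq maximal_linked_iff by blast+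

text \<open>The largest admissible choice for \<open>B a\<close> is
  \<open>{b. a * b \<in> E}\<close>, and the largest admissible \<open>A\<close> collects all
  \<open>a\<close> for which that set lies in \<open>\<B>\<close>. By upward closure it is enough to
  test these.\<close>

lemma mem_upmult_iff:
  fixes \<A> \<B> :: "'a::semigroup_mult set set"
  assumes "\<A> \<in> superext" "\<B> \<in> superext"
  shows "E \<in> upmult \<A> \<B> \<longleftrightarrow> {a. {b. a * b \<in> E} \<in> \<B>} \<in> \<A>"
proof
  assume "E \<in> upmult \<A> \<B>"
  then obtain A B where A: "A \<in> \<A>" and B: "\<forall>a\<in>A. B a \<in> \<B>"
    and sub: "(\<Union>a\<in>A. (\<lambda>b. a * b) ` B a) \<subseteq> E"
    unfolding upmult_def generated_def by auto
  have "{b. a * b \<in> E} \<in> \<B>" if "a \<in> A" for a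
  proof (rule superextD(1)[OF assms(2)])
    show "B a \<in> \<B>" using B that by simp
    show "B a \<subseteq> {b. a * b \<in> E}" using sub that by auto
  qed
  then have "A \<subseteq> {a. {b. a * b \<in> E} \<in> \<B>}" by (intro subsetI CollectI)
  then show "{a. {b. a * b \<in> E} \<in> \<B>} \<in> \<A>"
    by (rule superextD(1)[OF assms(1) A])
next
  let ?A = "{a. {b. a * b \<in> E} \<in> \<B>}"
  assume "?A \<in> \<A>"
  then have "(\<Union>a\<in>?A. (\<lambda>b. a * b) ` {b. a * b \<in> E}) \<in>
      {(\<Union>a\<in>A. (\<lambda>b. a * b) ` B a) | A B. A \<in> \<A> \<and> (\<forall>a\<in>A. B a \<in> \<B>)}"
    by (intro CollectI exI[of _ ?A] exI[of _ "\<lambda>a. {b. a * b \<in> E}"]) simp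
  then show "E \<in> upmult \<A> \<B>"
    unfolding upmult_def generated_def by (intro CollectI bexI) auto
qed

section \<open>Powers in a semigroup and their reduction by a coincidence\<close>

lemma spow_1: "spow x (Suc 0) = x"
  by (simp add: spow_def)

lemma spow_Suc: "k \<ge> 1 \<Longrightarrow> spow x (Suc k) = x * spow x k"
  by (cases k) (simp_all add: spow_def)

lemma spow_add:
  assumes "m \<ge> 1" "n \<ge> 1"
  shows "spow x (m + n) = spow x m * spow x n"
  using assms(1)
  by (induction m rule: dec_induct) (use assms(2) in \<open>simp_all add: spow_1 spow_Suc mult.assoc\<close>)

lemma spow_eq_shift:
  assumes "spow x n = spow x m" "n \<ge> 1" "m \<ge> 1"
  shows "spow x (n + k) = spow x (m + k)"
  using assms spow_add[of n k x] spow_add[of m k x] by (cases k) auto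

text \<open>An exponent \<open>m + d\<close> can be lowered to \<open>n + d\<close>; strong
  induction repeats this until the exponent is below \<open>m\<close>.\<close>

lemma spow_reduce:
  assumes "spow x n = spow x m" "1 \<le> n" "n < m" "k \<ge> 1"
  shows "\<exists>j. 1 \<le> j \<and> j < m \<and> spow x k = spow x j"
  using assms(4)
proof (induction k rule: less_induct)
  case (less k)
  show ?case
  proof (cases "k < m")
    case False
    then have "spow x k = spow x (n + (k - m))"
      using spow_eq_shift[OF assms(1), of "k - m"] assms by simp
    with less.IH[of "n + (k - m)"] assms False show ?thesis by simp
  qed (use less.prems in blast)
qed

section \<open>Necessity of a coincidence: majorities over three points\<close>

definition maj :: "bool \<Rightarrow> bool \<Rightarrow> bool \<Rightarrow> bool"
  where "maj p q r \<longleftrightarrow> p \<and> q \<or> p \<and> r \<or> q \<and> r"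

text \<open>If two of the points coincide, this is the principal ultrafilter at the repeated point,
  so the family is maximal linked for every choice of points.\<close>

definition triangle :: "'a \<Rightarrow> 'a \<Rightarrow> 'a \<Rightarrow> 'a set set"
  where "triangle u v w = {E. maj (u \<in> E) (v \<in> E) (w \<in> E)}"

lemma triangle_in_fin_superext: "triangle u v w \<in> fin_superext"
proof -
  have "maximal_linked (triangle u v w)"
    unfolding maximal_linked_iff triangle_def maj_def by blast
  moreover have "triangle u v w = generated {{u, v}, {u, w}, {v, w}}"
    by (auto simp: triangle_def maj_def generated_def)
  then have "finitely_supported (triangle u v w)"
    unfolding finitely_supported_def by (intro exI[of _ "{{u, v}, {u, w}, {v, w}}"]) simp
  ultimately show ?thesis
    unfolding fin_superext_def superext_def by simp
qed

text \<open>Turns commutativity into a propositional condition on pairwise products, which a single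
  set \<open>E\<close> can refute.\<close>

lemma triangles_commute:
  fixes u v w u' v' w' :: "'a::semigroup_mult"
  assumes "upmult_commutative_on (fin_superext :: 'a set set set)"
  shows "maj (maj (u * u' \<in> E) (u * v' \<in> E) (u * w' \<in> E))
             (maj (v * u' \<in> E) (v * v' \<in> E) (v * w' \<in> E))
             (maj (w * u' \<in> E) (w * v' \<in> E) (w * w' \<in> E))
     \<longleftrightarrow> maj (maj (u' * u \<in> E) (u' * v \<in> E) (u' * w \<in> E))
             (maj (v' * u \<in> E) (v' * v \<in> E) (v' * w \<in> E))
             (maj (w' * u \<in> E) (w' * v \<in> E) (w' * w \<in> E))"
proof -
  have sup: "triangle a b c \<in> superext" for a b c :: 'a
    using triangle_in_fin_superext[of a b c] unfolding fin_superext_def by blast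
  have "upmult (triangle u v w) (triangle u' v' w') = upmult (triangle u' v' w') (triangle u v w)"
    using assms[unfolded upmult_commutative_on_def, rule_format,
        OF triangle_in_fin_superext triangle_in_fin_superext] .
  then have "E \<in> upmult (triangle u v w) (triangle u' v' w') \<longleftrightarrow>
      E \<in> upmult (triangle u' v' w') (triangle u v w)" by simp
  then show ?thesis
    unfolding mem_upmult_iff[OF sup sup] by (simp add: triangle_def)
qed

lemma spow_coincidence_if_commutative:
  fixes x :: "'a::semigroup_mult"
  assumes comm: "upmult_commutative_on (fin_superext :: 'a set set set)"
  shows "\<exists>(n, m) \<in> {(1,2),(1,3),(2,3),(1,4),(2,4),(3,4),(1,5),(2,5),(3,5),(4,5),(2,6)}.
           spow x n = spow x m"
proof (rule ccontr)
  assume "\<not> ?thesis"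
  then have dist: "distinct [spow x 1, spow x 2, spow x 3, spow x 4, spow x 5]"
    and n26: "spow x 2 \<noteq> spow x 6"
    by auto
  \<comment> \<open>Here \<open>u, v, w\<close> have exponents 1, 2, 3 and \<open>u', v', w'\<close>
    have exponents 1, 2, 4; each entry is a sum of two exponents. In \<open>T34\<close> the second
    triple is 1, 3, 4.\<close>
  have T4: "maj (maj (spow x 2 \<in> E) (spow x 3 \<in> E) (spow x 5 \<in> E))
                (maj (spow x 3 \<in> E) (spow x 4 \<in> E) (spow x 6 \<in> E))
                (maj (spow x 4 \<in> E) (spow x 5 \<in> E) (spow x 7 \<in> E))
        \<longleftrightarrow> maj (maj (spow x 2 \<in> E) (spow x 3 \<in> E) (spow x 4 \<in> E))
                (maj (spow x 3 \<in> E) (spow x 4 \<in> E) (spow x 5 \<in> E))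
                (maj (spow x 5 \<in> E) (spow x 6 \<in> E) (spow x 7 \<in> E))" for E
    using triangles_commute[OF comm, of "spow x 1" "spow x 1" E "spow x 2" "spow x 4" "spow x 2" "spow x 3"]
    by (simp flip: spow_add add: numeral_2_eq_2[symmetric] numeral_3_eq_3[symmetric])
  have T34: "maj (maj (spow x 2 \<in> E) (spow x 4 \<in> E) (spow x 5 \<in> E))
                (maj (spow x 3 \<in> E) (spow x 5 \<in> E) (spow x 6 \<in> E))
                (maj (spow x 4 \<in> E) (spow x 6 \<in> E) (spow x 7 \<in> E))
        \<longleftrightarrow> maj (maj (spow x 2 \<in> E) (spow x 3 \<in> E) (spow x 4 \<in> E))
                (maj (spow x 4 \<in> E) (spow x 5 \<in> E) (spow x 6 \<in> E))
                (maj (spow x 5 \<in> E) (spow x 6 \<in> E) (spow x 7 \<in> E))" for E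
    using triangles_commute[OF comm, of "spow x 1" "spow x 1" E "spow x 3" "spow x 4" "spow x 2" "spow x 3"]
    by (simp flip: spow_add add: numeral_2_eq_2[symmetric] numeral_3_eq_3[symmetric])
  \<comment> \<open>For \<open>E\<close> = {x^3, x^4}, \<open>T4\<close> fails unless x^7 lies in
    \<open>E\<close>. This settles \<open>rest\<close>, and also \<open>six4\<close>, where x^7 =
    x^5. The other two cases have x^7 in {x^3, x^4} and require different sets.\<close>
  consider (six3) "spow x 6 = spow x 3" | (six4) "spow x 6 = spow x 4"
    | (seven) "spow x 6 \<noteq> spow x 3" "spow x 6 \<noteq> spow x 4" "spow x 7 \<in> {spow x 3, spow x 4}"
    | (rest) "spow x 6 \<noteq> spow x 3" "spow x 6 \<noteq> spow x 4" "spow x 7 \<notin> {spow x 3, spow x 4}"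
    by blast
  then show False
  proof cases
    case six3
    moreover from this have "spow x 7 = spow x 4"
      using spow_eq_shift[of x 6 3 1] by simp
    ultimately show False
      using T4[of "{spow x 4, spow x 5}"] dist n26 by (auto simp: maj_def)
  next
    case six4
    moreover from this have "spow x 7 = spow x 5"
      using spow_eq_shift[of x 6 4 1] by simp
    ultimately show False
      using T4[of "{spow x 3, spow x 4}"] dist n26 by (auto simp: maj_def)
  next
    case seven
    then show False
      using T34[of "{spow x 5, spow x 6}"] dist n26 by (auto simp: maj_def)
  next
    case rest
    then show False
      using T4[of "{spow x 3, spow x 4}"] dist n26 by (auto simp: maj_def)
  qed
qed

section \<open>Self-dual monotone functions of four Boolean variables\<close>

definition wmaj :: "bool \<Rightarrow> bool \<Rightarrow> bool \<Rightarrow> bool \<Rightarrow> bool"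
  where "wmaj p q r t \<longleftrightarrow> p \<and> (q \<or> r \<or> t) \<or> q \<and> r \<and> t"

lemma maj_simps:
  "maj True q r = (q \<or> r)" "maj False q r = (q \<and> r)"
  "maj p True r = (p \<or> r)" "maj p False r = (p \<and> r)"
  "maj p q True = (p \<or> q)" "maj p q False = (p \<and> q)"
  by (auto simp: maj_def)

lemma wmaj_simps:
  "wmaj True q r t = (q \<or> r \<or> t)" "wmaj False q r t = (q \<and> r \<and> t)"
  "wmaj p True r t = (p \<or> r \<and> t)" "wmaj p False r t = (p \<and> (r \<or> t))"
  by (auto simp: wmaj_def)

text \<open>All self-dual monotone Boolean functions of four variables, that is, the twelve maximal
  linked upfamilies on a four-element set; \<open>wmaj\<close> gives its first argument two votes.\<close>

definition selfdual4 :: "(bool \<Rightarrow> bool \<Rightarrow> bool \<Rightarrow> bool \<Rightarrow> bool) set"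
  where "selfdual4 =
   {\<lambda>p q r t. p, \<lambda>p q r t. q, \<lambda>p q r t. r, \<lambda>p q r t. t,
    \<lambda>p q r t. maj q r t, \<lambda>p q r t. maj p r t, \<lambda>p q r t. maj p q t, \<lambda>p q r t. maj p q r,
    \<lambda>p q r t. wmaj p q r t, \<lambda>p q r t. wmaj q p r t, \<lambda>p q r t. wmaj r p q t, \<lambda>p q r t. wmaj t p q r}"

text \<open>Duality and monotonicity leave seven values open: one true argument (four values), and
  two true arguments including the first (three values). If a single true argument suffices, the
  function is a projection; otherwise the three pair values are free and give the eight
  majorities.\<close>

lemma selfdual4I:
  fixes f :: "bool \<Rightarrow> bool \<Rightarrow> bool \<Rightarrow> bool \<Rightarrow> bool"
  assumes mono: "\<And>p q r t p' q' r' t'. f p q r t \<Longrightarrow>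
      p \<le> p' \<Longrightarrow> q \<le> q' \<Longrightarrow> r \<le> r' \<Longrightarrow> t \<le> t' \<Longrightarrow> f p' q' r' t'"
    and dual: "\<And>p q r t. f (\<not> p) (\<not> q) (\<not> r) (\<not> t) \<longleftrightarrow> \<not> f p q r t"
  shows "f \<in> selfdual4"
proof -
  have ext4: "f = g \<longleftrightarrow> (\<forall>p q r t. f p q r t = g p q r t)" for g
    by (auto simp: fun_eq_iff)
  have d: "f False True True True = (\<not> f True False False False)"
    "f True False True True = (\<not> f False True False False)"
    "f True True False True = (\<not> f False False True False)"
    "f True True True False = (\<not> f False False False True)"
    "f False False True True = (\<not> f True True False False)"
    "f False True False True = (\<not> f True False True False)"
    "f False True True False = (\<not> f True False False True)"
    "f False False False False = (\<not> f True True True True)"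
    using dual[of True False False False] dual[of False True False False]
      dual[of False False True False] dual[of False False False True]
      dual[of True True False False] dual[of True False True False] dual[of True False False True]
      dual[of True True True True] by simp_all
  have top: "f True True True True"
    using mono[of False False False False True True True True] d(8)
    by (cases "f True True True True") simp_all
  have m: "f True False False False \<Longrightarrow> f True True False False"
    "f True False False False \<Longrightarrow> f True False True False"
    "f True False False False \<Longrightarrow> f True False False True"
    "f False True False False \<Longrightarrow> f True True False False"
    "f False True False False \<Longrightarrow> f False True True False"
    "f False True False False \<Longrightarrow> f False True False True"
    "f False False True False \<Longrightarrow> f True False True False"
    "f False False True False \<Longrightarrow> f False True True False"
    "f False False True False \<Longrightarrow> f False False True True"
    "f False False False True \<Longrightarrow> f True False False True"
    "f False False False True \<Longrightarrow> f False True False True"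
    "f False False False True \<Longrightarrow> f False False True True"
    by (erule mono; simp)+
  show ?thesis
    unfolding selfdual4_def insert_iff empty_iff ext4
    by (simp add: all_bool_eq maj_simps wmaj_simps d top) (use m[unfolded d] in argo)
qed

text \<open>The \<open>pk\<close> stand for the truth values of x^k in \<open>E\<close>. The
  alternatives in \<open>eqs\<close> are the patterns forced by x^6 = x^2 and by x^5 = x^2, x^3,
  x^4. In each of them all 144 pairs of functions are checked on every assignment.\<close>

lemma selfdual4_commute:
  assumes f: "f \<in> selfdual4" and g: "g \<in> selfdual4"
    and eqs: "(p6, p7, p8) = (p2, p3, p4) \<or>
      (p5, p6, p7, p8) \<in> {(p2, p3, p4, p2), (p3, p4, p3, p4), (p4, p4, p4, p4)}"
  shows "f (g p2 p3 p4 p5) (g p3 p4 p5 p6) (g p4 p5 p6 p7) (g p5 p6 p7 p8) \<longleftrightarrow>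
         g (f p2 p3 p4 p5) (f p3 p4 p5 p6) (f p4 p5 p6 p7) (f p5 p6 p7 p8)"
proof -
  from eqs consider "p6 = p2" "p7 = p3" "p8 = p4" | "p5 = p2" "p6 = p3" "p7 = p4" "p8 = p2"
    | "p5 = p3" "p6 = p4" "p7 = p3" "p8 = p4" | "p5 = p4" "p6 = p4" "p7 = p4" "p8 = p4"
    by auto
  then show ?thesis
  proof cases
    case 1
    show ?thesis
      using f g unfolding selfdual4_def 1
      by (cases p2; cases p3; cases p4; cases p5; simp only:)
        (elim insertE emptyE; hypsubst; simp only: maj_simps wmaj_simps simp_thms)+
  next
    case 2
    show ?thesis
      using f g unfolding selfdual4_def 2
      by (cases p2; cases p3; cases p4; cases p5; simp only:)
        (elim insertE emptyE; hypsubst; simp only: maj_simps wmaj_simps simp_thms)+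
  next
    case 3
    show ?thesis
      using f g unfolding selfdual4_def 3
      by (cases p2; cases p3; cases p4; cases p5; simp only:)
        (elim insertE emptyE; hypsubst; simp only: maj_simps wmaj_simps simp_thms)+
  next
    case 4
    show ?thesis
      using f g unfolding selfdual4_def 4
      by (cases p2; cases p3; cases p4; cases p5; simp only:)
        (elim insertE emptyE; hypsubst; simp only: maj_simps wmaj_simps simp_thms)+
  qed
qed

section \<open>Sufficiency of a coincidence\<close>

text \<open>The indices have to recover products, not elements: elements with the same products may
  share an index. Sums of two indices run from 2 to 8, which are the exponents in
  \<open>eqs\<close>.\<close>

lemma superext_commutative_if_indexed:
  fixes x :: "'a::semigroup_mult" and s :: "'a \<Rightarrow> nat"
  assumes s: "\<And>a. s a \<in> {1..4}"
    and prod: "\<And>a b. a * b = spow x (s a + s b)"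
    and eqs: "(spow x 6, spow x 7, spow x 8) = (spow x 2, spow x 3, spow x 4) \<or>
      (spow x 5, spow x 6, spow x 7, spow x 8) \<in>
        {(spow x 2, spow x 3, spow x 4, spow x 2), (spow x 3, spow x 4, spow x 3, spow x 4),
         (spow x 4, spow x 4, spow x 4, spow x 4)}"
  shows "upmult_commutative_on (superext :: 'a set set set)"
  unfolding upmult_commutative_on_def
proof (intro ballI set_eqI)
  fix \<A> \<B> :: "'a set set" and E :: "'a set"
  assume \<A>: "\<A> \<in> superext" and \<B>: "\<B> \<in> superext"
  \<comment> \<open>A colouring of the indices 1 to 4; the default \<open>t\<close> is harmless
    because \<open>s\<close> takes no other values.\<close>
  define ch where "ch p q r t k = (if k = 1 then p else if k = 2 then q else if k = 3 then r else t)"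
    for p q r t :: bool and k :: nat
  \<comment> \<open>The image of \<open>\<F>\<close> under \<open>s\<close>, read as a Boolean
    function of a colouring of the four indices.\<close>
  define fn where "fn \<F> p q r t \<longleftrightarrow> {a. ch p q r t (s a)} \<in> \<F>" for \<F> p q r t
  have fn: "fn \<F> \<in> selfdual4" if "\<F> \<in> superext" for \<F>
  proof (rule selfdual4I)
    fix p q r t p' q' r' t'
    assume "fn \<F> p q r t" "p \<le> p'" "q \<le> q'" "r \<le> r'" "t \<le> t'"
    moreover from this have "{a. ch p q r t (s a)} \<subseteq> {a. ch p' q' r' t' (s a)}"
      unfolding ch_def by auto
    ultimately show "fn \<F> p' q' r' t'"
      using superextD(1)[OF that] unfolding fn_def by blast
  next
    fix p q r t
    have "{a. ch (\<not> p) (\<not> q) (\<not> r) (\<not> t) (s a)} = - {a. ch p q r t (s a)}"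
      unfolding ch_def by auto
    then show "fn \<F> (\<not> p) (\<not> q) (\<not> r) (\<not> t) \<longleftrightarrow> \<not> fn \<F> p q r t"
      using superextD(2)[OF that] unfolding fn_def by simp
  qed
  have mem: "{a. h (s a)} \<in> \<F> \<longleftrightarrow> fn \<F> (h 1) (h 2) (h 3) (h 4)" for \<F> h
  proof -
    have "h (s a) = ch (h 1) (h 2) (h 3) (h 4) (s a)" for a
    proof -
      have "s a = 1 \<or> s a = 2 \<or> s a = 3 \<or> s a = 4"
        using s[of a] by auto
      then show ?thesis unfolding ch_def by auto
    qed
    then show ?thesis unfolding fn_def by simp
  qed
  define P where "P k \<longleftrightarrow> spow x k \<in> E" for k
  \<comment> \<open>By \<open>prod\<close>, membership of \<open>a * b\<close> in \<open>E\<close>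
    depends only on \<open>s a + s b\<close>, so the row of index \<open>i\<close> consists of
    \<open>P\<close> at \<open>i + 1\<close> to \<open>i + 4\<close>.\<close>
  have up: "E \<in> upmult \<F> \<G> \<longleftrightarrow>
      fn \<F> (fn \<G> (P 2) (P 3) (P 4) (P 5)) (fn \<G> (P 3) (P 4) (P 5) (P 6))
           (fn \<G> (P 4) (P 5) (P 6) (P 7)) (fn \<G> (P 5) (P 6) (P 7) (P 8))"
    if "\<F> \<in> superext" "\<G> \<in> superext" for \<F> \<G>
  proof -
    have "E \<in> upmult \<F> \<G> \<longleftrightarrow> {a. {b. P (s a + s b)} \<in> \<G>} \<in> \<F>"
      using mem_upmult_iff[OF that] by (simp add: prod P_def)
    also have "\<dots> \<longleftrightarrow> {a. fn \<G> (P (s a + 1)) (P (s a + 2)) (P (s a + 3)) (P (s a + 4))} \<in> \<F>"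
      by (simp only: mem[of "\<lambda>k. P (s a + k)" for a])
    also have "\<dots> \<longleftrightarrow>
      fn \<F> (fn \<G> (P 2) (P 3) (P 4) (P 5)) (fn \<G> (P 3) (P 4) (P 5) (P 6))
           (fn \<G> (P 4) (P 5) (P 6) (P 7)) (fn \<G> (P 5) (P 6) (P 7) (P 8))"
      unfolding mem[of "\<lambda>k. fn \<G> (P (k + 1)) (P (k + 2)) (P (k + 3)) (P (k + 4))"]
      by (simp add: numeral_2_eq_2[symmetric])
    finally show ?thesis .
  qed
  have "(P 6, P 7, P 8) = (P 2, P 3, P 4) \<or>
      (P 5, P 6, P 7, P 8) \<in> {(P 2, P 3, P 4, P 2), (P 3, P 4, P 3, P 4), (P 4, P 4, P 4, P 4)}"
    using eqs unfolding P_def by (elim disjE insertE emptyE Pair_inject; simp)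
  then show "E \<in> upmult \<A> \<B> \<longleftrightarrow> E \<in> upmult \<B> \<A>"
    unfolding up[OF \<A> \<B>] up[OF \<B> \<A>] by (rule selfdual4_commute[OF fn[OF \<A>] fn[OF \<B>]])
qed

text \<open>Every coincidence with \<open>m \<le> 5\<close> shifts to an equation of x^5 with a
  lower power, and \<open>s\<close> then chooses an exponent. The pair (2, 6) is separate since five
  distinct powers may remain.\<close>

lemma superext_commutative_if_coincidence:
  fixes x :: "'a::semigroup_mult"
  assumes monogenic: "(UNIV :: 'a set) = {spow x k | k. k \<ge> 1}"
    and ex: "\<exists>(n, m) \<in> {(1,2),(1,3),(2,3),(1,4),(2,4),(3,4),(1,5),(2,5),(3,5),(4,5),(2,6)}.
               spow x n = spow x m"
  shows "upmult_commutative_on (superext :: 'a set set set)"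
proof -
  obtain n m where nm: "spow x n = spow x m"
    and mem: "(n, m) \<in> {(1,2),(1,3),(2,3),(1,4),(2,4),(3,4),(1,5),(2,5),(3,5),(4,5),(2,6)}"
    using ex by (elim bexE case_prodE) (rule that, assumption, hypsubst, assumption)
  have cases: "1 \<le> n \<and> n < m \<and> m \<le> 5 \<or> n = 2 \<and> m = 6"
    using mem by auto
  have n: "1 \<le> n" and "n < m" using cases by auto
  have reduce: "\<exists>j. 1 \<le> j \<and> j < m \<and> a = spow x j" for a
  proof -
    have "a \<in> {spow x k | k. k \<ge> 1}" using monogenic by blast
    then show ?thesis using spow_reduce[OF nm n \<open>n < m\<close>] by blast
  qed
  from cases show ?thesis
  proof
    assume m: "1 \<le> n \<and> n < m \<and> m \<le> 5"
    \<comment> \<open>Adding \<open>5 - m\<close> to both exponents normalises the coincidence to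
      x^5 = x^i.\<close>
    define i where "i = n + (5 - m)"
    have i: "i \<in> {1, 2, 3, 4}" unfolding i_def using m by auto
    have "spow x 5 = spow x i"
      using spow_eq_shift[OF nm, of "5 - m"] m by (simp add: i_def)
    then have "spow x (5 + k) = spow x (i + k)" for k
      using spow_eq_shift[of x 5 i k] i by auto
    from this[of 0] this[of 1] this[of 2] this[of 3]
    have P: "spow x 5 = spow x i" "spow x 6 = spow x (i + 1)" "spow x 7 = spow x (i + 2)"
      "spow x 8 = spow x (i + 3)" by simp_all
    have "\<exists>j. j \<in> {1..4} \<and> spow x j = a" for a
    proof -
      obtain j where "1 \<le> j" "j < m" "a = spow x j" using reduce[of a] by blast
      with m show ?thesis by (intro exI[of _ j]) simp
    qed
    then have "\<forall>a. \<exists>j. j \<in> {1..4} \<and> spow x j = a" by blast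
    from choice[OF this] obtain s where s: "\<And>a. s a \<in> {1..4}" "\<And>a. spow x (s a) = a"
      by blast
    show ?thesis
    proof (rule superext_commutative_if_indexed[OF s(1)])
      show "a * b = spow x (s a + s b)" for a b
        using s[of a] s[of b] by (simp add: spow_add)
    qed (use i P in \<open>elim insertE emptyE; simp flip: numeral_2_eq_2 numeral_3_eq_3\<close>)
  next
    assume m: "n = 2 \<and> m = 6"
    then have "spow x (2 + k) = spow x (6 + k)" for k
      using spow_eq_shift[OF nm] by simp
    from this[of 0] this[of 1] this[of 2]
    have P: "spow x 6 = spow x 2" "spow x 7 = spow x 3" "spow x 8 = spow x 4" by simp_all
    text \<open>Here \<open>x\<close> and \<open>x\<^sup>5\<close> have the same products with all elements, so both may get index 1.\<close>
    have "\<exists>j\<in>{1..4}. spow x j = a \<or> j = 1 \<and> spow x 5 = a" for a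
    proof -
      obtain j where j: "1 \<le> j" "j < 6" "a = spow x j" using reduce[of a] m by blast
      show ?thesis
      proof (cases "j = 5")
        case False
        with j show ?thesis by (intro bexI[of _ j]) auto
      qed (use j in \<open>auto intro: bexI[of _ 1]\<close>)
    qed
    then have "\<forall>a. \<exists>j. j \<in> {1..4} \<and> (spow x j = a \<or> j = 1 \<and> spow x 5 = a)"
      by blast
    from choice[OF this] obtain s where s: "\<And>a. s a \<in> {1..4}"
      and eq: "\<And>a. spow x (s a) = a \<or> s a = 1 \<and> spow x 5 = a"
      by blast
    \<comment> \<open>Positivity of \<open>k\<close> matters: x^5 and x themselves may differ, and
      agree only after multiplication.\<close>
    have five: "spow x (5 + k) = spow x (1 + k)" if "k \<ge> 1" for k
      using spow_eq_shift[OF P(1), of "k - 1"] that by (cases k) simp_all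
    have s1: "s a \<ge> 1" for a
      using s[of a] by simp
    have left: "a * spow x k = spow x (s a + k)" if "k \<ge> 1" for a k
      using eq[of a]
    proof
      assume "spow x (s a) = a"
      then show ?thesis using spow_add[OF s1[of a] that, of x] by simp
    next
      assume "s a = 1 \<and> spow x 5 = a"
      then show ?thesis using spow_add[of 5 k x] five[OF that] that by simp
    qed
    show ?thesis
    proof (rule superext_commutative_if_indexed[OF s])
      show "a * b = spow x (s a + s b)" for a b
        using eq[of b]
      proof
        assume "spow x (s b) = b"
        then show ?thesis using left[OF s1[of b], of a] by simp
      next
        assume "s b = 1 \<and> spow x 5 = b"
        then show ?thesis using left[of 5 a] five[OF s1[of a]] by (simp add: add.commute)
      qed
    qed (use P in simp)
  qed
qed

theorem theorem9p3:
  fixes x :: "'a::semigroup_mult"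
  assumes monogenic: "(UNIV :: 'a set) = {spow x k | k. k \<ge> 1}"
  shows "(upmult_commutative_on (superext :: 'a set set set)
            \<longleftrightarrow> upmult_commutative_on (fin_superext :: 'a set set set))
       \<and> (upmult_commutative_on (fin_superext :: 'a set set set)
            \<longleftrightarrow> (\<exists>(n, m) \<in> {(1,2),(1,3),(2,3),(1,4),(2,4),(3,4),(1,5),(2,5),(3,5),(4,5),(2,6)}.
                  spow x n = spow x m))"
proof -
  have "upmult_commutative_on (fin_superext :: 'a set set set)"
    if "upmult_commutative_on (superext :: 'a set set set)"
    using that unfolding upmult_commutative_on_def fin_superext_def by blast
  with spow_coincidence_if_commutative[of x] superext_commutative_if_coincidence[OF monogenic]
  show ?thesis by iprover
qed

end
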